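(* The restriction of the class $[\overline{C}_{X^*}]$ to $\operatorname{SO}_2^\pm(\mathbb{R})$ is not trivial; that is, the central extension of $\operatorname{SO}_2^\pm(\mathbb{R})$ by $T$ defined by $\overline{C}_{X^*}$ does not split (its class in measurable $H^2(\operatorname{SO}_2^\pm(\mathbb{R}),T)$ is nonzero).
   Context: $T=\{z\in\mathbb{C}:|z|=1\}$, $\operatorname{SL}_2^\pm(\mathbb{R})=\{h\in\operatorname{GL}_2(\mathbb{R}):\det h=\pm1\}$, $\operatorname{SO}_2^\pm(\mathbb{R})=\left\{\begin{pmatrix}\cos\theta&\sin\theta\\ \mp\sin\theta&\pm\cos\theta\end{pmatrix}:-\pi<\theta\le\pi\right\}$ (the full orthogonal group). $(a,b)_{\mathbb{R}}$ is the real Hilbert symbol: $-1$ if $a<0$ and $b<0$, and $1$ otherwise. For $g=\begin{pmatrix}a&b\\c&d\end{pmatrix}\in\operatorname{SL}_2(\mathbb{R})$ let $x(g)=d\,\mathbb{R}^{\times2}$ if $c=0$, $x(g)=c\,\mathbb{R}^{\times2}$ if $c\ne0$, and $$\overline{c}_{X^*}(g_1,g_2)=(x(g_1),x(g_2))_{\mathbb{R}}\,(-x(g_1)x(g_2),x(g_1g_2))_{\mathbb{R}}.$$ For $y=\pm1$, $g^y=\begin{pmatrix}1&0\\0&y\end{pmatrix}^{-1}g\begin{pmatrix}1&0\\0&y\end{pmatrix}$, and $\nu_2(y,g)=(y,a)_{\mathbb{R}}$ if $c=0$, $\nu_2(y,g)=1$ if $c\neq0$. For $h_1,h_2\in\operatorname{SL}_2^\pm(\mathbb{R})$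 write $h_i=\begin{pmatrix}1&0\\0&y_i\end{pmatrix}g_i$ with $y_i=\det h_i$, $g_i\in\operatorname{SL}_2(\mathbb{R})$. Then $\overline{C}_{X^*}(h_1,h_2)=\nu_2(y_2,g_1)\,\overline{c}_{X^*}(g_1^{y_2},g_2)$, a $\mu_2$-valued Borel 2-cocycle on $\operatorname{SL}_2^\pm(\mathbb{R})$, regarded as $T$-valued. *)

theory Defs
  imports "HOL-Analysis.Analysis" "HOL-Algebra.Coset"
begin


text \<open>
  Moore cohomology in degree two with trivial action: Borel 2-cocycles modulo coboundaries
  of Borel 1-cochains. Groups are HOL-Algebra groups whose carrier is a subset of a topological
  space and carries the Borel structure of the subspace topology. Cochains are extensional
  functions, so that each has a unique representative.
\<close>

definition circle :: "complex set"
  where "circle = {z. norm z = 1}"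

definition cochains1 :: "('a::topological_space, 'b) monoid_scheme \<Rightarrow> ('a \<Rightarrow> complex) set"
  where "cochains1 G =
    (carrier G \<rightarrow>\<^sub>E circle) \<inter> borel_measurable (restrict_space borel (carrier G))"

definition cochains2 :: "('a::topological_space, 'b) monoid_scheme \<Rightarrow> ('a \<times> 'a \<Rightarrow> complex) set"
  where "cochains2 G =
    (carrier G \<times> carrier G \<rightarrow>\<^sub>E circle) \<inter>
      borel_measurable (restrict_space borel (carrier G \<times> carrier G))"

definition Z2 :: "('a::topological_space, 'b) monoid_scheme \<Rightarrow> ('a \<times> 'a \<Rightarrow> complex) monoid"
  where "Z2 G =
    \<lparr>carrier = {f \<in> cochains2 G. \<forall>x\<in>carrier G. \<forall>y\<in>carrier G. \<forall>z\<in>carrier G.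
        f (x, y) * f (x \<otimes>\<^bsub>G\<^esub> y, z) = f (x, y \<otimes>\<^bsub>G\<^esub> z) * f (y, z)},
     mult = (\<lambda>f f'. \<lambda>p\<in>carrier G \<times> carrier G. f p * f' p),
     one = (\<lambda>p\<in>carrier G \<times> carrier G. 1)\<rparr>"

definition coboundary ::
  "('a, 'b) monoid_scheme \<Rightarrow> ('a \<Rightarrow> complex) \<Rightarrow> ('a \<times> 'a \<Rightarrow> complex)"
  where "coboundary G \<beta> =
    (\<lambda>(x, y)\<in>carrier G \<times> carrier G. \<beta> x * \<beta> y / \<beta> (x \<otimes>\<^bsub>G\<^esub> y))"

definition B2 :: "('a::topological_space, 'b) monoid_scheme \<Rightarrow> ('a \<times> 'a \<Rightarrow> complex) set"
  where "B2 G = coboundary G ` cochains1 G"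

definition H2 :: "('a::topological_space, 'b) monoid_scheme \<Rightarrow> ('a \<times> 'a \<Rightarrow> complex) set monoid"
  where "H2 G = Z2 G Mod B2 G"

definition H2_class ::
  "('a::topological_space, 'b) monoid_scheme \<Rightarrow> ('a \<times> 'a \<Rightarrow> complex) \<Rightarrow> ('a \<times> 'a \<Rightarrow> complex) set"
  where "H2_class G f = B2 G #>\<^bsub>Z2 G\<^esub> f"

text \<open>
  The unit is \<open>(f(1,1)\<inverse>, 1)\<close> since cocycles are not required to be normalized.
\<close>

definition central_extension ::
  "('a, 'b) monoid_scheme \<Rightarrow> ('a \<times> 'a \<Rightarrow> complex) \<Rightarrow> (complex \<times> 'a) monoid"
  where "central_extension G f =
    \<lparr>carrier = circle \<times> carrier G,
     mult = (\<lambda>(s, x) (t, y). (s * t * f (x, y), x \<otimes>\<^bsub>G\<^esub> y)),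
     one = (inverse (f (\<one>\<^bsub>G\<^esub>, \<one>\<^bsub>G\<^esub>)), \<one>\<^bsub>G\<^esub>)\<rparr>"

text \<open>
  Splitting is meant in the Borel category: the section is a Borel homomorphism.
\<close>

definition splits :: "('a::topological_space, 'b) monoid_scheme \<Rightarrow> ('a \<times> 'a \<Rightarrow> complex) \<Rightarrow> bool"
  where "splits G f \<longleftrightarrow>
    (\<exists>\<sigma> \<in> hom G (central_extension G f).
       \<sigma> \<in> borel_measurable (restrict_space borel (carrier G)) \<and>
       (\<forall>x\<in>carrier G. snd (\<sigma> x) = x))"



type_synonym mat2 = "real^2^2"

definition mat2 :: "real \<Rightarrow> real \<Rightarrow> real \<Rightarrow> real \<Rightarrow> mat2"
  where "mat2 a b c d = vector [vector [a, b], vector [c, d]]"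

definition SL2pm :: "mat2 set"
  where "SL2pm = {h. invertible h \<and> (det h = 1 \<or> det h = -1)}"

definition SO2pm :: "mat2 set"
  where "SO2pm = {mat2 (cos \<theta>) (sin \<theta>) (- \<epsilon> * sin \<theta>) (\<epsilon> * cos \<theta>) | \<theta> \<epsilon>.
    - pi < \<theta> \<and> \<theta> \<le> pi \<and> \<epsilon> \<in> {1, -1}}"

definition matrix_group :: "mat2 set \<Rightarrow> mat2 monoid"
  where "matrix_group S = \<lparr>carrier = S, mult = (**), one = mat 1\<rparr>"



definition hilbert :: "real \<Rightarrow> real \<Rightarrow> real"
  where "hilbert a b = (if a < 0 \<and> b < 0 then -1 else 1)"

text \<open>
  A representative of the square class \<open>x(g)\<close>. The symbol \<^const>\<open>hilbert\<close>, into which all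
  values of \<open>x\<close> are fed, depends only on the classes of its arguments modulo nonzero squares.
\<close>

definition x_repr :: "mat2 \<Rightarrow> real"
  where "x_repr g = (if g $ 2 $ 1 = 0 then g $ 2 $ 2 else g $ 2 $ 1)"

definition c_Xstar :: "mat2 \<Rightarrow> mat2 \<Rightarrow> real"
  where "c_Xstar g1 g2 =
    hilbert (x_repr g1) (x_repr g2) * hilbert (- x_repr g1 * x_repr g2) (x_repr (g1 ** g2))"

definition conj_y :: "mat2 \<Rightarrow> real \<Rightarrow> mat2"
  where "conj_y g y = matrix_inv (mat2 1 0 0 y) ** g ** mat2 1 0 0 y"

definition nu2 :: "real \<Rightarrow> mat2 \<Rightarrow> real"
  where "nu2 y g = (if g $ 2 $ 1 = 0 then hilbert y (g $ 1 $ 1) else 1)"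

text \<open>
  The factor \<open>g\<close> in \<open>h = diag(1, det h) g\<close>.
\<close>

definition sl_part :: "mat2 \<Rightarrow> mat2"
  where "sl_part h = matrix_inv (mat2 1 0 0 (det h)) ** h"

definition C_Xstar :: "mat2 \<Rightarrow> mat2 \<Rightarrow> real"
  where "C_Xstar h1 h2 =
    nu2 (det h2) (sl_part h1) * c_Xstar (conj_y (sl_part h1) (det h2)) (sl_part h2)"

definition C_Xstar_cochain :: "mat2 \<times> mat2 \<Rightarrow> complex"
  where "C_Xstar_cochain = (\<lambda>(h1, h2)\<in>SL2pm \<times> SL2pm. complex_of_real (C_Xstar h1 h2))"

end

theory Submission imports Defs begin

text \<open>
  An element of the orthogonal group is a pair of a point \<open>z\<close> of the unit circle (its top row) and
  its determinant \<open>e\<close>, and these pairs multiply by \<open>(z, d) (w, e) = (z\<^sup>e w, d e)\<close>, where \<open>z\<^sup>e\<close> is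
  \<open>z\<close> or its conjugate.  In these coordinates the cocycle is
  \<open>C ((z, d), (w, e)) = (\<surd>z)\<^sup>e \<surd>w / \<surd>(z\<^sup>e w)\<close>
  with the principal square root (lemma \<open>C_Xstar_O2\<close>).  So \<open>C\<close> measures the failure of the
  principal square root to be a section of the double cover formed by the pairs \<open>(u, e)\<close> with the
  same multiplication, the covering map being \<open>(u, e) \<mapsto> (u\<^sup>2, e)\<close>.  The two ingredients are:

  \<^item> On rotations, the two Hilbert symbols detect whether the sum of the principal arguments
    leaves the interval \<open>(-\<pi>, \<pi>]\<close>, which is exactly when the product of the square roots is minus
    the square root of the product (lemmas \<open>principal_product_iff\<close> and \<open>hilbert_eq_csqrt\<close>).
  \<^item> The principal square root commutes with conjugation on the circle except at \<open>-1\<close>, and there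
    the factor \<open>\<nu>\<^sub>2\<close> supplies the missing sign (lemma \<open>nu2_csqrt\<close>).

  The formula makes the cocycle identity and Borel measurability immediate.

  On \<open>SO\<^sub>2\<close> alone the square root would exhibit \<open>C\<close> as a coboundary, so the obstruction has to
  involve a reflection.  A coboundary takes equal values at \<open>(x, y)\<close> and \<open>(y, x)\<close> when \<open>x\<close> and
  \<open>y\<close> commute, and so does every cocycle whose extension splits.  The central element \<open>-I\<close>
  commutes with \<open>diag(1, -1)\<close>, but its lift \<open>\<surd>(-1) = \<i>\<close> is sent to \<open>-\<i>\<close> by conjugation: the
  values of \<open>C\<close> at the two orderings are \<open>-1\<close> and \<open>1\<close>.
\<close>

section \<open>Classes in degree two and commuting elements\<close>

lemma H2_class_in_carrier: "f \<in> carrier (Z2 G) \<Longrightarrow> H2_class G f \<in> carrier (H2 G)"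
  by (auto simp: H2_class_def H2_def FactGroup_def RCOSETS_def)

lemma trivial_cocycle_in_B2:
  assumes "monoid G"
  shows "\<one>\<^bsub>Z2 G\<^esub> \<in> B2 G"
proof -
  interpret monoid G by fact
  have "(\<lambda>x\<in>carrier G. 1) \<in> cochains1 G"
    by (auto simp: cochains1_def circle_def space_restrict_space
        intro!: measurable_cong[THEN iffD2, OF _ measurable_const])
  moreover have "\<one>\<^bsub>Z2 G\<^esub> = coboundary G (\<lambda>x\<in>carrier G. 1)"
    by (auto simp: Z2_def coboundary_def fun_eq_iff restrict_def)
  ultimately show ?thesis
    unfolding B2_def by blast
qed

lemma H2_class_trivial_imp_B2:
  assumes "monoid G" "f \<in> carrier (Z2 G)" "H2_class G f = \<one>\<^bsub>H2 G\<^esub>"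
  shows "f \<in> B2 G"
proof -
  have "f = (\<lambda>p\<in>carrier G \<times> carrier G. 1 * f p)"
    using assms(2) by (auto simp: Z2_def cochains2_def fun_eq_iff PiE_def extensional_def)
  also have "\<dots> = \<one>\<^bsub>Z2 G\<^esub> \<otimes>\<^bsub>Z2 G\<^esub> f"
    by (auto simp: Z2_def fun_eq_iff)
  finally have "f \<in> B2 G #>\<^bsub>Z2 G\<^esub> f"
    using trivial_cocycle_in_B2[OF assms(1)] unfolding r_coset_def by blast
  then show ?thesis
    using assms(3) by (simp add: H2_class_def H2_def FactGroup_def)
qed

lemma B2_commute:
  assumes "f \<in> B2 G" "x \<in> carrier G" "y \<in> carrier G" "x \<otimes>\<^bsub>G\<^esub> y = y \<otimes>\<^bsub>G\<^esub> x"
  shows "f (x, y) = f (y, x)"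
  using assms by (auto simp: B2_def coboundary_def mult.commute)

text \<open>
  The lifts of commuting elements along a section that is a homomorphism commute, and the circle
  coordinates of the two products differ only by the values of the cocycle.
\<close>

lemma splits_commute:
  assumes "splits G f" and xy: "x \<in> carrier G" "y \<in> carrier G" "x \<otimes>\<^bsub>G\<^esub> y = y \<otimes>\<^bsub>G\<^esub> x"
  shows "f (x, y) = f (y, x)"
proof -
  obtain \<sigma> where hom: "\<sigma> \<in> hom G (central_extension G f)" and sec: "\<forall>x\<in>carrier G. snd (\<sigma> x) = x"
    using assms(1) by (auto simp: splits_def)
  define s where "s = fst \<circ> \<sigma>"
  have \<sigma>: "\<sigma> u = (s u, u)" if "u \<in> carrier G" for u
    using sec that by (simp add: s_def prod_eq_iff)
  have s_mult: "s (u \<otimes>\<^bsub>G\<^esub> v) = s u * s v * f (u, v)" if "u \<in> carrier G" "v \<in> carrier G" for u v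
  proof -
    have "s (u \<otimes>\<^bsub>G\<^esub> v) = fst (\<sigma> u \<otimes>\<^bsub>central_extension G f\<^esub> \<sigma> v)"
      using hom_mult[OF hom that] by (simp add: s_def)
    also have "\<dots> = s u * s v * f (u, v)"
      unfolding \<sigma>[OF that(1)] \<sigma>[OF that(2)] by (simp add: central_extension_def)
    finally show ?thesis .
  qed
  have "s u \<noteq> 0" if "u \<in> carrier G" for u
    using hom_in_carrier[OF hom that] \<sigma>[OF that]
    by (auto simp: central_extension_def circle_def)
  then show ?thesis
    using s_mult[OF xy(1,2)] s_mult[OF xy(2,1)] xy by simp
qed

section \<open>Hilbert symbols and principal square roots on the circle\<close>

text \<open>
  The function \<^const>\<open>x_repr\<close> on the rotation with top row \<open>z\<close>.
\<close>

definition circle_x :: "complex \<Rightarrow> real"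
  where "circle_x z = (if Im z = 0 then Re z else - Im z)"

text \<open>
  Both sides say that the principal argument of \<open>z\<close> lies in \<open>(0, \<pi>]\<close>.
\<close>

lemma circle_x_neg_iff:
  assumes "norm z = 1"
  shows "circle_x z < 0 \<longleftrightarrow> Im (csqrt z) > 0"
proof -
  have sq: "(Re z)\<^sup>2 + (Im z)\<^sup>2 = 1"
    using assms by (simp add: cmod_def)
  have "Im z = 0 \<Longrightarrow> Re z = 1 \<or> Re z = - 1"
    using sq by (simp add: power2_eq_1_iff)
  moreover have "Im z \<noteq> 0 \<Longrightarrow> Re z < 1"
    by (smt (verit) sq power2_eq_square zero_less_power2 one_le_power)
  ultimately show ?thesis
    using assms by (auto simp: circle_x_def sgn_if zero_less_mult_iff)
qed

lemma circle_x_nonzero: "norm z = 1 \<Longrightarrow> circle_x z \<noteq> 0"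
  by (auto simp: circle_x_def cmod_def)

text \<open>
  Numbers in the half-plane of principal square roots have arguments in \<open>(-\<pi>/2, \<pi>/2]\<close>.  The
  sum of two of them can only leave this range if both are positive or both are not.  Leaving it
  means that the representative \<open>c\<close> in the half-plane is minus the product; its argument is then
  shifted by \<open>\<pi>\<close>, so that it is positive exactly when those of the factors are not.
\<close>

lemma principal_product_iff:
  fixes a b c :: complex
  assumes a: "0 < Re a \<or> Re a = 0 \<and> 0 < Im a"
    and b: "0 < Re b \<or> Re b = 0 \<and> 0 < Im b"
    and c: "0 < Re c \<or> Re c = 0 \<and> 0 < Im c"
    and cab: "c = a * b \<or> c = - (a * b)"
  shows "c = a * b \<longleftrightarrow>
    \<not> (0 < Im a \<and> 0 < Im b \<and> \<not> 0 < Im c \<or> \<not> 0 < Im a \<and> \<not> 0 < Im b \<and> 0 < Im c)"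
proof -
  define p where "p = a * b"
  have re: "Re p = Re a * Re b - Im a * Im b" and im: "Im p = Re a * Im b + Im a * Re b"
    by (simp_all add: p_def)
  have ne: "p \<noteq> - p"
    using a b by (auto simp: p_def)
  have cp: "c = p \<or> c = - p"
    using cab by (simp add: p_def)
  consider (pp) "0 < Im a" "0 < Im b" | (nn) "Im a \<le> 0" "Im b \<le> 0"
    | (pn) "0 < Im a" "Im b \<le> 0" | (np) "Im a \<le> 0" "0 < Im b"
    by linarith
  then show ?thesis
  proof cases
    case pp
    have "0 < Im p \<or> Im p = 0 \<and> Re p < 0"
    proof (cases "Re a = 0 \<and> Re b = 0")
      case True
      then show ?thesis using pp by (simp add: re im)
    next
      case False
      then have "0 < Re a * Im b \<or> 0 < Im a * Re b"
        using a b pp by auto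
      moreover have "0 \<le> Re a * Im b" "0 \<le> Im a * Re b"
        using a b pp by auto
      ultimately show ?thesis unfolding im by linarith
    qed
    then show ?thesis using pp c cp ne unfolding p_def[symmetric] by auto
  next
    case nn
    then have ra: "0 < Re a" and rb: "0 < Re b"
      using a b by auto
    have le: "Re a * Im b \<le> 0" "Im a * Re b \<le> 0"
      using nn ra rb by (auto simp: mult_le_0_iff)
    have "Im p < 0 \<or> Im p = 0 \<and> 0 < Re p"
    proof (cases "Im a = 0 \<and> Im b = 0")
      case True
      then show ?thesis using ra rb by (simp add: re im)
    next
      case False
      then have "Re a * Im b < 0 \<or> Im a * Re b < 0"
        using nn ra rb by (auto simp: mult_less_0_iff)
      then show ?thesis using le unfolding im by linarith
    qed
    then show ?thesis using nn c cp ne unfolding p_def[symmetric] by auto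
  next
    case pn
    then have rb: "0 < Re b" using b by auto
    have "0 \<le> Re a * Re b" "Im a * Im b \<le> 0"
      using a rb pn by (auto simp: mult_le_0_iff)
    moreover have "0 < Im p" if "Re p = 0"
    proof -
      have "Re a * Re b = 0" "Im a * Im b = 0"
        using that calculation by (auto simp: re)
      then show ?thesis using rb pn by (auto simp: im)
    qed
    ultimately have "0 < Re p \<or> Re p = 0 \<and> 0 < Im p"
      by (auto simp: re)
    then show ?thesis using pn c cp ne unfolding p_def[symmetric] by auto
  next
    case np
    then have ra: "0 < Re a" using a by auto
    have "0 \<le> Re a * Re b" "Im a * Im b \<le> 0"
      using b ra np by (auto simp: mult_le_0_iff)
    moreover have "0 < Im p" if "Re p = 0"
    proof -
      have "Re a * Re b = 0" "Im a * Im b = 0"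
        using that calculation by (auto simp: re)
      then show ?thesis using ra np by (auto simp: im)
    qed
    ultimately have "0 < Re p \<or> Re p = 0 \<and> 0 < Im p"
      by (auto simp: re)
    then show ?thesis using np c cp ne unfolding p_def[symmetric] by auto
  qed
qed

text \<open>
  The left-hand side is the value of \<^const>\<open>c_Xstar\<close> at two rotations.  Its first symbol is \<open>-1\<close>
  when both arguments are positive; its second is \<open>-1\<close> when the arguments are of the same kind,
  positive or not, and the argument of the product is positive.  Together they give \<open>-1\<close> in the
  two exceptional cases of \<open>principal_product_iff\<close>.
\<close>

lemma hilbert_eq_csqrt:
  assumes z: "norm z = 1" and w: "norm w = 1"
  shows "complex_of_real (hilbert (circle_x z) (circle_x w) *
           hilbert (- circle_x z * circle_x w) (circle_x (z * w))) =
         csqrt z * csqrt w / csqrt (z * w)"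
proof -
  define a b c where "a = csqrt z" and "b = csqrt w" and "c = csqrt (z * w)"
  have zw: "norm (z * w) = 1"
    using z w by (simp add: norm_mult)
  have ne: "a \<noteq> 0" "b \<noteq> 0"
    using z w by (auto simp: a_def b_def)
  have principal: "0 < Re a \<or> Re a = 0 \<and> 0 < Im a" "0 < Re b \<or> Re b = 0 \<and> 0 < Im b"
    "0 < Re c \<or> Re c = 0 \<and> 0 < Im c"
    using z w zw csqrt_principal unfolding a_def b_def c_def
    by (metis csqrt_eq_0 complex_eq_iff zero_complex.sel norm_zero zero_neq_one order_le_less)+
  have "c\<^sup>2 = (a * b)\<^sup>2"
    by (simp add: a_def b_def c_def power_mult_distrib)
  then have cab: "c = a * b \<or> c = - (a * b)"
    by (simp add: power2_eq_iff)
  have quotient: "a * b / c = (if c = a * b then 1 else - 1)"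
    using cab ne by auto
  have "- circle_x z * circle_x w < 0 \<longleftrightarrow> (0 < Im a \<longleftrightarrow> 0 < Im b)"
    using circle_x_neg_iff[OF z] circle_x_neg_iff[OF w] circle_x_nonzero[OF z] circle_x_nonzero[OF w]
    unfolding a_def b_def by (auto simp del: csqrt.sel simp: zero_less_mult_iff)
  then have "hilbert (circle_x z) (circle_x w) *
      hilbert (- circle_x z * circle_x w) (circle_x (z * w)) = (if c = a * b then 1 else - 1)"
    using circle_x_neg_iff[OF z] circle_x_neg_iff[OF w] circle_x_neg_iff[OF zw]
    unfolding principal_product_iff[OF principal cab] hilbert_def a_def[symmetric]
      b_def[symmetric] c_def[symmetric]
    by auto
  then show ?thesis
    unfolding a_def[symmetric] b_def[symmetric] c_def[symmetric] quotient by simp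
qed

lemma csqrt_measurable [measurable]: "csqrt \<in> borel_measurable borel"
proof -
  have "(\<lambda>z. Complex (Re (csqrt z)) (Im (csqrt z))) \<in> borel_measurable borel"
    unfolding csqrt.sel Complex_eq by measurable
  then show ?thesis
    unfolding complex_surj .
qed

section \<open>Coordinates on the orthogonal group\<close>

lemma mat2_entries [simp]:
  "mat2 a b c d $ 1 $ 1 = a" "mat2 a b c d $ 1 $ 2 = b"
  "mat2 a b c d $ 2 $ 1 = c" "mat2 a b c d $ 2 $ 2 = d"
  by (simp_all add: mat2_def)

lemma mat2_eq_iff:
  fixes A B :: mat2
  shows "A = B \<longleftrightarrow> A $ 1 $ 1 = B $ 1 $ 1 \<and> A $ 1 $ 2 = B $ 1 $ 2 \<and>
    A $ 2 $ 1 = B $ 2 $ 1 \<and> A $ 2 $ 2 = B $ 2 $ 2"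
  by (auto simp: vec_eq_iff forall_2)

lemma mat2_mult:
  "mat2 a b c d ** mat2 a' b' c' d' =
     mat2 (a * a' + b * c') (a * b' + b * d') (c * a' + d * c') (c * b' + d * d')"
  by (simp add: mat2_eq_iff matrix_matrix_mult_def sum_2)

lemma mat_1_eq_mat2: "mat 1 = mat2 1 0 0 1"
  by (simp add: mat2_eq_iff mat_def)

lemma det_mat2: "det (mat2 a b c d) = a * d - b * c"
  by (simp add: det_2)

lemma matrix_inv_eqI:
  fixes A B :: "real^'n^'n"
  assumes "A ** B = mat 1" "B ** A = mat 1"
  shows "matrix_inv A = B"
proof -
  have "A ** matrix_inv A = mat 1 \<and> matrix_inv A ** A = mat 1"
    unfolding matrix_inv_def by (rule someI[of _ B]) (use assms in simp)
  then show ?thesis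
    by (metis assms(1) matrix_mul_assoc matrix_mul_lid matrix_mul_rid)
qed

lemma matrix_inv_diag: "y = 1 \<or> y = - 1 \<Longrightarrow> matrix_inv (mat2 1 0 0 y) = mat2 1 0 0 y"
  by (rule matrix_inv_eqI) (auto simp: mat2_mult mat_1_eq_mat2)

text \<open>
  The action of a determinant \<open>e = \<plusminus>1\<close> on the circle: on rotations, conjugation by \<open>diag(1, -1)\<close>
  is complex conjugation.
\<close>

definition twist :: "real \<Rightarrow> complex \<Rightarrow> complex"
  where "twist e z = (if e < 0 then cnj z else z)"

lemma twist_simps [simp]:
  "twist 1 z = z" "twist (- 1) z = cnj z" "norm (twist e z) = norm z"
  "twist e (of_real r) = of_real r"
  by (simp_all add: twist_def)

lemma twist_mult: "twist e (z * w) = twist e z * twist e w"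
  and twist_divide: "twist e (z / w) = twist e z / twist e w"
  and twist_eq_0_iff: "twist e z = 0 \<longleftrightarrow> z = 0"
  by (simp_all add: twist_def)

lemma twist_twist:
  "d = 1 \<or> d = - 1 \<Longrightarrow> e = 1 \<or> e = - 1 \<Longrightarrow> twist e (twist d z) = twist (d * e) z"
  by auto

definition O2 :: "complex \<Rightarrow> real \<Rightarrow> mat2"
  where "O2 z e = mat2 (Re z) (Im z) (- e * Im z) (e * Re z)"

lemma O2_mult: "e = 1 \<or> e = - 1 \<Longrightarrow> O2 z d ** O2 w e = O2 (twist e z * w) (d * e)"
  by (auto simp: O2_def mat2_mult mat2_eq_iff algebra_simps)

lemma O2_one: "O2 1 1 = mat 1"
  by (simp add: O2_def mat_1_eq_mat2)

lemma det_O2: "norm z = 1 \<Longrightarrow> det (O2 z e) = e"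
proof -
  assume "norm z = 1"
  then have "(Re z)\<^sup>2 + (Im z)\<^sup>2 = 1" by (simp add: cmod_def)
  then have "e * ((Re z)\<^sup>2 + (Im z)\<^sup>2) = e" by simp
  then show ?thesis
    by (simp add: O2_def det_mat2 algebra_simps power2_eq_square)
qed

lemma SO2pm_eq: "SO2pm = {O2 z e | z e. norm z = 1 \<and> (e = 1 \<or> e = - 1)}"
proof (intro equalityI subsetI)
  fix h assume "h \<in> SO2pm"
  then obtain t e where "h = O2 (cis t) e" "e = 1 \<or> e = - 1"
    by (auto simp: SO2pm_def O2_def)
  then show "h \<in> {O2 z e | z e. norm z = 1 \<and> (e = 1 \<or> e = - 1)}"
    using norm_cis by blast
next
  fix h assume "h \<in> {O2 z e | z e. norm z = 1 \<and> (e = 1 \<or> e = - 1)}"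
  then obtain z e where h: "h = O2 z e" and z: "norm z = 1" and e: "e = 1 \<or> e = - 1"
    by blast
  have "z = cis (Arg z)"
    using z by (metis cis_Arg complex_sgn_def norm_zero scaleR_one inverse_1 zero_neq_one)
  then have "Re z = cos (Arg z)" "Im z = sin (Arg z)"
    by (metis cis.simps)+
  then show "h \<in> SO2pm"
    using h e Arg_bounded[of z] by (auto simp: SO2pm_def O2_def)
qed

lemma O2_in_SO2pm: "norm z = 1 \<Longrightarrow> e = 1 \<or> e = - 1 \<Longrightarrow> O2 z e \<in> SO2pm"
  by (auto simp: SO2pm_eq)

lemma SO2pm_cases:
  assumes "h \<in> SO2pm"
  obtains z e where "h = O2 z e" "norm z = 1" "e = 1 \<or> e = - 1"
  using assms by (auto simp: SO2pm_eq)

lemma SO2pm_mult_closed: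
  assumes "g \<in> SO2pm" "h \<in> SO2pm"
  shows "g ** h \<in> SO2pm"
  using assms by (elim SO2pm_cases) (auto simp: O2_mult norm_mult intro!: O2_in_SO2pm)

lemma monoid_matrix_group_SO2pm: "monoid (matrix_group SO2pm)"
  using O2_in_SO2pm[of 1 1]
  by unfold_locales (auto simp: matrix_group_def SO2pm_mult_closed O2_one matrix_mul_assoc)

lemma SO2pm_subset_SL2pm: "SO2pm \<subseteq> SL2pm"
proof
  fix h assume "h \<in> SO2pm"
  then have "det h = 1 \<or> det h = - 1"
    by (auto elim!: SO2pm_cases simp: det_O2)
  then show "h \<in> SL2pm"
    by (auto simp: SL2pm_def invertible_det_nz)
qed

section \<open>The cocycle in terms of square roots\<close>

lemma sl_part_O2:
  assumes "norm z = 1" "e = 1 \<or> e = - 1"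
  shows "sl_part (O2 z e) = O2 z 1"
  using assms(2) unfolding sl_part_def det_O2[OF assms(1)] matrix_inv_diag[OF assms(2)]
  by (auto simp: O2_def mat2_mult mat2_eq_iff)

lemma conj_y_O2: "e = 1 \<or> e = - 1 \<Longrightarrow> conj_y (O2 z 1) e = O2 (twist e z) 1"
  by (auto simp: conj_y_def matrix_inv_diag O2_def mat2_mult mat2_eq_iff)

lemma c_Xstar_O2:
  assumes "norm z = 1" "norm w = 1"
  shows "complex_of_real (c_Xstar (O2 z 1) (O2 w 1)) = csqrt z * csqrt w / csqrt (z * w)"
proof -
  have "x_repr (O2 u 1) = circle_x u" for u
    by (simp add: x_repr_def O2_def circle_x_def)
  then show ?thesis
    using hilbert_eq_csqrt[OF assms] by (simp add: c_Xstar_def O2_mult)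
qed

text \<open>
  The only point of the circle on the branch cut of the square root is \<open>-1\<close>.  There the symbol in
  \<^const>\<open>nu2\<close> is \<open>-1\<close> for \<open>e = -1\<close>, in accordance with \<open>cnj \<i> = - \<i>\<close>; everywhere else it is \<open>1\<close>.
\<close>

lemma nu2_csqrt:
  assumes "norm z = 1" "e = 1 \<or> e = - 1"
  shows "complex_of_real (nu2 e (O2 z 1)) * csqrt (twist e z) = twist e (csqrt z)"
proof (cases "z = - 1")
  case True
  then show ?thesis
    using assms(2) by (auto simp: nu2_def O2_def hilbert_def)
next
  case False
  have "z \<notin> \<real>\<^sub>\<le>\<^sub>0"
    using assms(1) False
    by (auto simp: complex_nonpos_Reals_iff cmod_def complex_eq_iff power2_eq_1_iff)
  moreover from this have "nu2 e (O2 z 1) = 1"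
    using assms(1) by (auto simp: nu2_def O2_def hilbert_def complex_nonpos_Reals_iff)
  ultimately show ?thesis
    using assms(2) cnj_csqrt[of z] by auto
qed

lemma C_Xstar_O2:
  assumes "norm z = 1" "norm w = 1" "d = 1 \<or> d = - 1" "e = 1 \<or> e = - 1"
  shows "complex_of_real (C_Xstar (O2 z d) (O2 w e)) =
    twist e (csqrt z) * csqrt w / csqrt (twist e z * w)"
  using assms nu2_csqrt[OF assms(1,4), symmetric]
  by (simp add: C_Xstar_def sl_part_O2 det_O2 conj_y_O2 c_Xstar_O2)

lemma C_Xstar_values: "C_Xstar g h = 1 \<or> C_Xstar g h = - 1"
  by (auto simp: C_Xstar_def c_Xstar_def nu2_def hilbert_def)

text \<open>
  In terms of square roots both sides are the same product of three roots divided by the root of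
  the triple product.  The values of the cocycle are real, hence not affected by the twist with
  the last determinant, and this is what makes the intermediate roots cancel.
\<close>

lemma C_Xstar_cocycle:
  assumes "g \<in> SO2pm" "h \<in> SO2pm" "k \<in> SO2pm"
  shows "C_Xstar g h * C_Xstar (g ** h) k = C_Xstar g (h ** k) * C_Xstar h k"
proof -
  obtain z1 e1 where g: "g = O2 z1 e1" and z1: "norm z1 = 1" and e1: "e1 = 1 \<or> e1 = - 1"
    using assms(1) by (rule SO2pm_cases)
  obtain z2 e2 where h: "h = O2 z2 e2" and z2: "norm z2 = 1" and e2: "e2 = 1 \<or> e2 = - 1"
    using assms(2) by (rule SO2pm_cases)
  obtain z3 e3 where k: "k = O2 z3 e3" and z3: "norm z3 = 1" and e3: "e3 = 1 \<or> e3 = - 1"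
    using assms(3) by (rule SO2pm_cases)
  define z12 z23 z123 where "z12 = twist e2 z1 * z2" and "z23 = twist e3 z2 * z3"
    and "z123 = twist e3 z12 * z3"
  have norms: "norm z12 = 1" "norm z23 = 1" "norm z123 = 1"
    using z1 z2 z3 by (simp_all add: z12_def z23_def z123_def norm_mult)
  have z123': "z123 = twist (e2 * e3) z1 * z23"
    using e2 e3 by (simp add: z123_def z12_def z23_def twist_mult twist_twist)
  have signs: "e1 * e2 = 1 \<or> e1 * e2 = - 1" "e2 * e3 = 1 \<or> e2 * e3 = - 1"
    using e1 e2 e3 by auto
  have gh: "g ** h = O2 z12 (e1 * e2)" and hk: "h ** k = O2 z23 (e2 * e3)"
    using e2 e3 by (simp_all add: g h k z12_def z23_def O2_mult)
  have "complex_of_real (C_Xstar g h) = twist e3 (complex_of_real (C_Xstar g h))"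
    by simp
  also have "\<dots> = twist (e2 * e3) (csqrt z1) * twist e3 (csqrt z2) / twist e3 (csqrt z12)"
    using z1 z2 e1 e2 e3
    \<comment> \<open>The rule for real arguments would undo the twist just introduced.\<close>
    by (simp del: twist_simps(4)
        add: g h C_Xstar_O2 twist_mult twist_divide twist_twist z12_def)
  finally have 1: "complex_of_real (C_Xstar g h) =
      twist (e2 * e3) (csqrt z1) * twist e3 (csqrt z2) / twist e3 (csqrt z12)" .
  have 2: "complex_of_real (C_Xstar (g ** h) k) =
      twist e3 (csqrt z12) * csqrt z3 / csqrt z123"
    unfolding gh k z123_def using norms(1) z3 signs(1) e3 by (rule C_Xstar_O2)
  have 3: "complex_of_real (C_Xstar g (h ** k)) =
      twist (e2 * e3) (csqrt z1) * csqrt z23 / csqrt z123"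
    unfolding hk g z123' using z1 norms(2) e1 signs(2) by (rule C_Xstar_O2)
  have 4: "complex_of_real (C_Xstar h k) = twist e3 (csqrt z2) * csqrt z3 / csqrt z23"
    unfolding h k z23_def using z2 z3 e2 e3 by (rule C_Xstar_O2)
  have "z12 \<noteq> 0" "z23 \<noteq> 0"
    using norms by auto
  then have "complex_of_real (C_Xstar g h * C_Xstar (g ** h) k) =
      complex_of_real (C_Xstar g (h ** k) * C_Xstar h k)"
    by (simp add: 1 2 3 4 twist_eq_0_iff)
  then show ?thesis
    by (simp only: of_real_eq_iff)
qed

lemma C_Xstar_borel_measurable:
  "(\<lambda>p. complex_of_real (C_Xstar (fst p) (snd p)))
     \<in> borel_measurable (restrict_space borel (SO2pm \<times> SO2pm))"
proof -
  define \<zeta> :: "mat2 \<Rightarrow> complex" where "\<zeta> h = Complex (h $ 1 $ 1) (h $ 1 $ 2)" for h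
  define F :: "mat2 \<times> mat2 \<Rightarrow> complex" where
    "F p = twist (det (snd p)) (csqrt (\<zeta> (fst p))) * csqrt (\<zeta> (snd p)) /
      csqrt (twist (det (snd p)) (\<zeta> (fst p)) * \<zeta> (snd p))" for p
  have \<zeta>_O2: "\<zeta> (O2 z e) = z" for z e
    by (simp add: \<zeta>_def O2_def)
  have [measurable]: "(\<lambda>p. \<zeta> (fst p)) \<in> borel_measurable borel"
    "(\<lambda>p. \<zeta> (snd p)) \<in> borel_measurable borel"
    unfolding \<zeta>_def Complex_eq
    by (intro borel_measurable_continuous_onI continuous_intros)+
  have [measurable]: "(\<lambda>p :: mat2 \<times> mat2. det (snd p)) \<in> borel_measurable borel"
    unfolding det_2 by (intro borel_measurable_continuous_onI continuous_intros)
  have [measurable]: "cnj \<in> borel_measurable borel"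
    by (intro borel_measurable_continuous_onI continuous_intros)
  have "F \<in> borel_measurable borel"
    unfolding F_def twist_def by measurable
  then have "F \<in> borel_measurable (restrict_space borel (SO2pm \<times> SO2pm))"
    by (rule measurable_restrict_space1)
  moreover have "complex_of_real (C_Xstar (fst p) (snd p)) = F p" if "p \<in> SO2pm \<times> SO2pm" for p
    using that
    by (auto elim!: SO2pm_cases simp del: csqrt.sel simp: F_def \<zeta>_O2 det_O2 C_Xstar_O2)
  ultimately show ?thesis
    by (subst measurable_cong[where g = F]) (auto simp: space_restrict_space)
qed

lemma restrict_C_Xstar_cochain:
  "g \<in> SO2pm \<Longrightarrow> h \<in> SO2pm \<Longrightarrow>
    restrict C_Xstar_cochain (SO2pm \<times> SO2pm) (g, h) = complex_of_real (C_Xstar g h)"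
  using SO2pm_subset_SL2pm by (auto simp: C_Xstar_cochain_def)

lemma C_Xstar_in_Z2:
  "restrict C_Xstar_cochain (SO2pm \<times> SO2pm) \<in> carrier (Z2 (matrix_group SO2pm))"
proof -
  let ?f = "restrict C_Xstar_cochain (SO2pm \<times> SO2pm)"
  have "?f \<in> borel_measurable (restrict_space borel (SO2pm \<times> SO2pm))"
    using C_Xstar_borel_measurable
    by (rule measurable_cong[THEN iffD1, rotated])
      (auto simp: space_restrict_space restrict_C_Xstar_cochain simp del: restrict_apply)
  moreover have "?f \<in> SO2pm \<times> SO2pm \<rightarrow>\<^sub>E circle"
  proof (rule PiE_I)
    fix p assume "p \<in> SO2pm \<times> SO2pm"
    then show "?f p \<in> circle"
      using C_Xstar_values[of "fst p" "snd p"] restrict_C_Xstar_cochain[of "fst p" "snd p"]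
      by (auto simp: circle_def simp del: restrict_apply)
  qed auto
  moreover have "?f (g, h) * ?f (g ** h, k) = ?f (g, h ** k) * ?f (h, k)"
    if "g \<in> SO2pm" "h \<in> SO2pm" "k \<in> SO2pm" for g h k
    using that C_Xstar_cocycle[OF that] SO2pm_mult_closed
    by (simp add: restrict_C_Xstar_cochain flip: of_real_mult del: restrict_apply)
  ultimately show ?thesis
    by (auto simp: Z2_def cochains2_def matrix_group_def simp del: restrict_apply)
qed

section \<open>Nontriviality\<close>

text \<open>
  The witnesses are \<open>-I\<close> and \<open>diag(1, -1)\<close>, with square roots \<open>\<i>\<close> and \<open>1\<close>.  In the order
  \<open>(-I, diag(1, -1))\<close> the root \<open>\<i>\<close> is conjugated; in the other order only \<open>1\<close> is acted on, by the
  determinant \<open>1\<close>.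
\<close>

lemma C_Xstar_not_symmetric:
  obtains x y where "x \<in> SO2pm" "y \<in> SO2pm" "x ** y = y ** x" "C_Xstar x y \<noteq> C_Xstar y x"
proof
  show "O2 (- 1) 1 \<in> SO2pm" "O2 1 (- 1) \<in> SO2pm"
    by (auto intro: O2_in_SO2pm)
  show "O2 (- 1) 1 ** O2 1 (- 1) = O2 1 (- 1) ** O2 (- 1) 1"
    by (simp add: O2_mult)
  have "complex_of_real (C_Xstar (O2 (- 1) 1) (O2 1 (- 1))) = - 1"
    by (subst C_Xstar_O2) auto
  moreover have "complex_of_real (C_Xstar (O2 1 (- 1)) (O2 (- 1) 1)) = 1"
    by (subst C_Xstar_O2) auto
  ultimately show "C_Xstar (O2 (- 1) 1) (O2 1 (- 1)) \<noteq> C_Xstar (O2 1 (- 1)) (O2 (- 1) 1)"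
    by auto
qed

theorem lemma6p8:
  "H2_class (matrix_group SO2pm) (restrict C_Xstar_cochain (SO2pm \<times> SO2pm))
       \<in> carrier (H2 (matrix_group SO2pm))
   \<and> H2_class (matrix_group SO2pm) (restrict C_Xstar_cochain (SO2pm \<times> SO2pm))
       \<noteq> \<one>\<^bsub>H2 (matrix_group SO2pm)\<^esub>
   \<and> \<not> splits (matrix_group SO2pm) (restrict C_Xstar_cochain (SO2pm \<times> SO2pm))"
proof -
  let ?G = "matrix_group SO2pm" and ?f = "restrict C_Xstar_cochain (SO2pm \<times> SO2pm)"
  obtain x y where xy: "x \<in> SO2pm" "y \<in> SO2pm" "x ** y = y ** x" "C_Xstar x y \<noteq> C_Xstar y x"
    by (rule C_Xstar_not_symmetric)
  have G: "x \<in> carrier ?G" "y \<in> carrier ?G" "x \<otimes>\<^bsub>?G\<^esub> y = y \<otimes>\<^bsub>?G\<^esub> x"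
    using xy by (simp_all add: matrix_group_def)
  have asym: "?f (x, y) \<noteq> ?f (y, x)"
    using xy by (simp add: restrict_C_Xstar_cochain del: restrict_apply)
  have "H2_class ?G ?f \<noteq> \<one>\<^bsub>H2 ?G\<^esub>"
    using H2_class_trivial_imp_B2[OF monoid_matrix_group_SO2pm C_Xstar_in_Z2] B2_commute[OF _ G] asym
    by blast
  moreover have "\<not> splits ?G ?f"
    using splits_commute[OF _ G] asym by blast
  ultimately show ?thesis
    using H2_class_in_carrier[OF C_Xstar_in_Z2] by blast
qed

end
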